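(* For every complex number $q$ with $0<|q|<1$, \[ \sum_{k=1}^{\infty}q^{2k^2}[8k+1]\frac{(q;q^2)_{k}^2(q;q^2)_{2k}}{(q^2;q^2)_{2k}(q^6;q^6)_{k}^2}\sum_{i=1}^{k}\left\{\frac{q^{2i-1}}{[2i-1]^2}-\frac{q^{6i}}{[6i]^2}\right\} =\frac{(q^3;q^2)_{\infty}(q^3;q^6)_{\infty}}{(q^2;q^2)_{\infty}(q^6;q^6)_{\infty}}\sum_{j=1}^{\infty}(-1)^{j-1}\frac{q^{3j}}{[3j]^2}. \]
   Context: For complex $x,q$ with $|q|<1$: $(x;q)_\infty=\prod_{i\ge 0}(1-xq^i)$ and, for an integer $n\ge 0$, $(x;q)_n=\prod_{i=0}^{n-1}(1-xq^i)$. Multiple arguments mean products: $(x_1,\dots,x_r;q)_m=(x_1;q)_m\cdots(x_r;q)_m$. The $q$-integer is $[n]=1+q+\cdots+q^{n-1}=(1-q^n)/(1-q)$. *)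

theory Defs
  imports "HOL-Analysis.Analysis"
begin

definition qpoch :: "complex \<Rightarrow> complex \<Rightarrow> nat \<Rightarrow> complex" where
  "qpoch x q n = (\<Prod>i<n. 1 - x * q ^ i)"

definition qpoch_inf :: "complex \<Rightarrow> complex \<Rightarrow> complex" where
  "qpoch_inf x q = (\<Prod>i. 1 - x * q ^ i)"

definition qint :: "complex \<Rightarrow> nat \<Rightarrow> complex" where
  "qint q n = (\<Sum>i<n. q ^ i)"

end

theory Submission
  imports Defs "HOL-Complex_Analysis.Complex_Analysis"
begin

text \<open>
  Deform the summand by two parameters: replace \<open>(q;q\<^sup>2)\<^sub>k\<^sup>2\<close> by \<open>(qx,q/x;q\<^sup>2)\<^sub>k\<close>, \<open>(q;q\<^sup>2)\<^sub>2\<^sub>k\<close> by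
  \<open>(qd;q\<^sup>2)\<^sub>2\<^sub>k\<close>, and \<open>(q\<^sup>6;q\<^sup>6)\<^sub>k\<^sup>2\<close> by \<open>(dq\<^sup>6x,dq\<^sup>6/x;q\<^sup>6)\<^sub>k\<close>. A WZ pair in \<open>k\<close> and \<open>d\<close> shows that the
  series \<open>S(d)\<close> satisfies a first order recurrence under \<open>d \<mapsto> dq\<^sup>6\<close>. Iterating it from \<open>d = 1\<close> and
  from \<open>d = q\<^sup>3\<close>, where the series telescopes outright, expresses \<open>S(0)\<close> in two ways, which
  evaluates \<open>S(1)\<close> as an infinite product. By the symmetry \<open>x \<leftrightarrow> 1/x\<close> everything depends only on
  \<open>u = x + 1/x - 2\<close>, and the theorem is the derivative of this evaluation at \<open>u = 0\<close>.
\<close>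

text \<open>With \<open>u = x + 1/x - 2\<close> this is \<open>(1 - xy)(1 - y/x)\<close>.\<close>

definition quad :: "complex \<Rightarrow> complex \<Rightarrow> complex" where
  "quad u y = (1 - y)\<^sup>2 - u * y"

section \<open>The deformed summand and its ratios in \<open>k\<close> and in
  \<open>d\<close>\<close>

definition cubic_weight :: "complex \<Rightarrow> complex \<Rightarrow> complex \<Rightarrow> nat \<Rightarrow> complex" where
  "cubic_weight q u d k =
     q ^ (2 * k\<^sup>2) * (\<Prod>i<k. quad u (q ^ (2 * i + 1))) * qpoch (q * d) (q\<^sup>2) (2 * k)
       / (qpoch (q\<^sup>2) (q\<^sup>2) (2 * k) * (\<Prod>i<k. quad u (d * q ^ (6 * i + 6))))"

text \<open>At \<open>d = 1\<close>, \<open>u = 0\<close> this is \<open>1 - q\<close> times the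
  summand of the theorem without its inner sum, because the linear factor is then
  \<open>(1 - q) * qint q (8 * k + 1)\<close>.\<close>

definition cubic_term :: "complex \<Rightarrow> complex \<Rightarrow> complex \<Rightarrow> nat \<Rightarrow> complex" where
  "cubic_term q u d k = (1 - d * q ^ (8 * k + 1)) * cubic_weight q u d k"

lemma qpoch_Suc: "qpoch x q (Suc n) = qpoch x q n * (1 - x * q ^ n)"
  by (simp add: qpoch_def)

lemma qpoch_Suc_shift: "qpoch x q (Suc n) = (1 - x) * qpoch (x * q) q n"
  unfolding qpoch_def by (subst prod.lessThan_Suc_shift) (simp add: mult_ac)

text \<open>Both sides are \<open>qpoch x q (n + 3)\<close>, with three factors split off at the
  front on the left and at the end on the right.\<close>

lemma qpoch_shift3:
  "(1 - x) * (1 - x * q) * (1 - x * q\<^sup>2) * qpoch (x * q ^ 3) q n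
     = qpoch x q n * (1 - x * q ^ n) * (1 - x * q ^ (n + 1)) * (1 - x * q ^ (n + 2))"
proof -
  have "qpoch x q (Suc (Suc (Suc n))) = (1 - x) * (1 - x * q) * (1 - x * q\<^sup>2) * qpoch (x * q ^ 3) q n"
    unfolding qpoch_Suc_shift by (simp add: power2_eq_square power3_eq_cube mult_ac)
  then show ?thesis by (simp add: qpoch_Suc mult_ac)
qed

lemma pow_less_one: "norm q < 1 \<Longrightarrow> 0 < n \<Longrightarrow> norm (q ^ n) < 1" for q :: complex
  by (simp add: norm_power power_less_one_iff)

lemma pow_neq_one: "norm q < 1 \<Longrightarrow> 0 < n \<Longrightarrow> q ^ n \<noteq> 1" for q :: complex
  using pow_less_one[of q n] by auto

lemma norm_geometric_term_less:
  fixes q x :: complex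
  assumes "norm q < 1" "norm x < 1"
  shows "norm (x * q ^ n) < 1"
proof -
  have "norm (q ^ n) \<le> 1" using assms by (simp add: norm_power power_le_one)
  then have "norm x * norm (q ^ n) \<le> norm x" by (simp add: mult_left_le)
  then show ?thesis using assms by (simp add: norm_mult)
qed

lemma qpoch_nonzero:
  assumes "norm q < 1" "norm x < 1"
  shows "qpoch x q n \<noteq> 0"
  using norm_geometric_term_less[OF assms] unfolding qpoch_def
  by (metis (no_types, lifting) finite_lessThan norm_one order_less_irrefl prod_zero_iff right_minus_eq)

text \<open>The weight is hypergeometric in \<open>k\<close>. This rational ratio reduces every
  telescoping claim to a polynomial identity in \<open>q ^ (2 * k)\<close>.\<close>

lemma cubic_weight_Suc:
  "cubic_weight q u d (Suc k) = cubic_weight q u d k *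
     (q ^ (4 * k + 2) * quad u (q ^ (2 * k + 1)) * (1 - d * q ^ (4 * k + 1)) * (1 - d * q ^ (4 * k + 3))
       / ((1 - q ^ (4 * k + 2)) * (1 - q ^ (4 * k + 4)) * quad u (d * q ^ (6 * k + 6))))"
proof -
  have e: "q ^ (2 * (Suc k)\<^sup>2) = q ^ (2 * k\<^sup>2) * q ^ (4 * k + 2)"
    by (simp add: power2_eq_square power_add[symmetric] algebra_simps)
  have a: "qpoch x (q\<^sup>2) (2 * Suc k) = qpoch x (q\<^sup>2) (2 * k) * (1 - x * q ^ (4 * k)) * (1 - x * q ^ (4 * k + 2))" for x
    by (simp add: qpoch_Suc power_mult[symmetric] power_add[symmetric])
  have b: "q * d * q ^ (4 * k) = d * q ^ (4 * k + 1)" "q * d * q ^ (4 * k + 2) = d * q ^ (4 * k + 3)"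
      "q\<^sup>2 * q ^ (4 * k) = q ^ (4 * k + 2)" "q\<^sup>2 * q ^ (4 * k + 2) = q ^ (4 * k + 4)"
    by (simp_all add: power_add power2_eq_square eval_nat_numeral mult_ac)
  show ?thesis
    unfolding cubic_weight_def e a b by (simp add: divide_inverse mult_ac)
qed

text \<open>Replacing \<open>d\<close> by \<open>d * q ^ 6\<close> moves the argument of
  \<open>qpoch (q * d) (q\<^sup>2)\<close> by three steps, which is \<open>qpoch_shift3\<close>, and
  moves the index of the product of \<open>quad\<close> factors by one.\<close>

lemma cubic_weight_shift:
  assumes "1 - q ^ 3 * d \<noteq> 0" and E: "\<And>i. quad u (d * q ^ (6 * i + 6)) \<noteq> 0"
  shows "(1 - q * d) * (1 - q ^ 5 * d) * cubic_weight q u (d * q ^ 6) k =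
     quad u (d * q ^ 6) * cubic_weight q u d k *
     ((1 - d * q ^ (4 * k + 1)) * (1 - d * q ^ (4 * k + 3)) * (1 - d * q ^ (4 * k + 5))
       / ((1 - q ^ 3 * d) * quad u (d * q ^ (6 * k + 6))))"
proof -
  have q6: "q * (d * q ^ 6) = q * d * (q\<^sup>2) ^ 3" by (simp add: power_mult[symmetric] mult_ac)
  have B: "(1 - q * d) * (1 - q ^ 5 * d) * qpoch (q * (d * q ^ 6)) (q\<^sup>2) (2 * k)
     = qpoch (q * d) (q\<^sup>2) (2 * k) * (1 - d * q ^ (4 * k + 1)) * (1 - d * q ^ (4 * k + 3)) * (1 - d * q ^ (4 * k + 5))
      / (1 - q ^ 3 * d)"
  proof -
    have b: "q * d * q\<^sup>2 = q ^ 3 * d" "q * d * (q\<^sup>2)\<^sup>2 = q ^ 5 * d"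
       "q * d * (q\<^sup>2) ^ (2 * k) = d * q ^ (4 * k + 1)"
       "q * d * (q\<^sup>2) ^ (2 * k + 1) = d * q ^ (4 * k + 3)"
       "q * d * (q\<^sup>2) ^ (2 * k + 2) = d * q ^ (4 * k + 5)"
      by (simp_all add: power_mult[symmetric] power_add eval_nat_numeral power_mult_distrib mult_ac)
    show ?thesis
      using qpoch_shift3[of "q * d" "q\<^sup>2" "2 * k"] assms(1) unfolding q6 b
      by (simp add: field_simps)
  qed
  have P: "(\<Prod>i<k. quad u (d * q ^ 6 * q ^ (6 * i + 6))) =
      (\<Prod>i<k. quad u (d * q ^ (6 * i + 6))) * quad u (d * q ^ (6 * k + 6)) / quad u (d * q ^ 6)"
  proof -
    have "(\<Prod>i<Suc k. quad u (d * q ^ (6 * i + 6))) =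
       quad u (d * q ^ 6) * (\<Prod>i<k. quad u (d * q ^ 6 * q ^ (6 * i + 6)))"
      by (subst prod.lessThan_Suc_shift) (simp add: power_add[symmetric] mult.assoc add_ac)
    then show ?thesis using E[of 0] by (simp add: field_simps)
  qed
  have "(1 - q * d) * (1 - q ^ 5 * d) * cubic_weight q u (d * q ^ 6) k =
     q ^ (2 * k\<^sup>2) * (\<Prod>i<k. quad u (q ^ (2 * i + 1))) *
      ((1 - q * d) * (1 - q ^ 5 * d) * qpoch (q * (d * q ^ 6)) (q\<^sup>2) (2 * k))
       / (qpoch (q\<^sup>2) (q\<^sup>2) (2 * k) * (\<Prod>i<k. quad u (d * q ^ 6 * q ^ (6 * i + 6))))"
    unfolding cubic_weight_def by simp
  also have "\<dots> =  quad u (d * q ^ 6) * cubic_weight q u d k *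
     ((1 - d * q ^ (4 * k + 1)) * (1 - d * q ^ (4 * k + 3)) * (1 - d * q ^ (4 * k + 5))
       / ((1 - q ^ 3 * d) * quad u (d * q ^ (6 * k + 6))))"
    unfolding B P cubic_weight_def by (simp add: divide_inverse mult_ac)
  finally show ?thesis .
qed

section \<open>Telescoping certificates\<close>

text \<open>The companion of \<open>cubic_term\<close> in the WZ pair. For \<open>k > 0\<close> the
  last two factors cancel the last two factors of
  \<open>qpoch (q\<^sup>2) (q\<^sup>2) (2 * k)\<close>, and at \<open>k = 0\<close> the first of
  them vanishes. Dividing by \<open>q\<^sup>2\<close> expresses the exponent
  \<open>4 * k - 2\<close> without truncated subtraction.\<close>

definition wz_cert :: "complex \<Rightarrow> complex \<Rightarrow> complex \<Rightarrow> nat \<Rightarrow> complex" where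
  "wz_cert q u d k = quad u (d * q ^ 6) * (q ^ 3 * d / (1 - q ^ 3 * d)) * cubic_weight q u d k
       * (1 - q ^ (4 * k)) * (1 - q ^ (4 * k) / q\<^sup>2)"

text \<open>The WZ equation after removal of a common factor, with \<open>Q\<close> standing for
  \<open>q ^ (2 * k)\<close>.\<close>

lemma wz_poly:
  fixes q Q d u :: complex
  assumes "q \<noteq> 0"
  shows "(1 - d * q * Q ^ 4) * quad u (d * q ^ 6 * Q ^ 3) * (1 - q ^ 3 * d)
      - (1 - d * q ^ 7 * Q ^ 4) * ((1 - d * q * Q\<^sup>2) * (1 - d * q ^ 3 * Q\<^sup>2) * (1 - d * q ^ 5 * Q\<^sup>2))
    = q ^ 3 * d * (q\<^sup>2 * Q\<^sup>2 * quad u (q * Q) * (1 - d * q * Q\<^sup>2) * (1 - d * q ^ 3 * Q\<^sup>2)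
      - quad u (d * q ^ 6 * Q ^ 3) * (1 - Q\<^sup>2) * (1 - Q\<^sup>2 / q\<^sup>2))"
proof -
  \<comment> \<open>The only non-polynomial factor gets a name. The prefactor \<open>q ^ 3\<close>
    supplies the \<open>q\<^sup>2\<close> that clears its denominator, and what remains is a
    polynomial identity.\<close>
  define r where "r = 1 - Q\<^sup>2 / q\<^sup>2"
  have r: "q\<^sup>2 * r = q\<^sup>2 - Q\<^sup>2"
    using assms by (simp add: r_def field_simps)
  have "q ^ 3 * d * (q\<^sup>2 * Q\<^sup>2 * quad u (q * Q) * (1 - d * q * Q\<^sup>2) * (1 - d * q ^ 3 * Q\<^sup>2)
      - quad u (d * q ^ 6 * Q ^ 3) * (1 - Q\<^sup>2) * r)
      = q ^ 3 * d * (q\<^sup>2 * Q\<^sup>2 * quad u (q * Q) * (1 - d * q * Q\<^sup>2) * (1 - d * q ^ 3 * Q\<^sup>2))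
      - q * d * quad u (d * q ^ 6 * Q ^ 3) * (1 - Q\<^sup>2) * (q\<^sup>2 * r)"
    by (simp add: algebra_simps eval_nat_numeral)
  then show ?thesis unfolding r_def[symmetric] r quad_def by algebra
qed

lemma wz_identity:
  assumes q: "0 < norm q" "norm q < 1" and d: "1 - q ^ 3 * d \<noteq> 0"
    and E: "\<And>i. quad u (d * q ^ (6 * i + 6)) \<noteq> 0"
  shows "quad u (d * q ^ 6) * cubic_term q u d k
       - (1 - q * d) * (1 - q ^ 5 * d) * cubic_term q u (d * q ^ 6) k
       = wz_cert q u d (Suc k) - wz_cert q u d k"
proof -
  define Q where "Q = q ^ (2 * k)"
  \<comment> \<open>The common factor of all four terms: each becomes \<open>W\<close> times one of
    the expressions in \<open>wz_poly\<close>.\<close>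
  define W where "W = quad u (d * q ^ 6) * cubic_weight q u d k / ((1 - q ^ 3 * d) * quad u (d * q ^ 6 * Q ^ 3))"
  have q0: "q \<noteq> 0" using q by auto
  have pw: "q ^ (4 * k) = Q\<^sup>2" "q ^ (6 * k) = Q ^ 3" "q ^ (8 * k) = Q ^ 4"
    by (simp_all add: Q_def power_mult[symmetric] mult.commute)
  have ex: "q ^ (4 * k + 2) = q\<^sup>2 * Q\<^sup>2" "q ^ (4 * k + 4) = q ^ 4 * Q\<^sup>2" "q ^ (2 * k + 1) = q * Q"
    "q ^ (4 * k + 1) = q * Q\<^sup>2" "q ^ (4 * k + 3) = q ^ 3 * Q\<^sup>2" "q ^ (4 * k + 5) = q ^ 5 * Q\<^sup>2"
    "q ^ (6 * k + 6) = q ^ 6 * Q ^ 3" "q ^ (8 * k + 1) = q * Q ^ 4" "q ^ (4 * Suc k) = q ^ 4 * Q\<^sup>2"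
    by (simp_all add: power_add pw Q_def[symmetric] power2_eq_square)
  have E': "quad u (d * q ^ 6 * Q ^ 3) \<noteq> 0"
    using E[of k] by (simp add: ex mult.assoc)
  have n: "1 - Q\<^sup>2 * q\<^sup>2 \<noteq> 0" "1 - Q\<^sup>2 * q ^ 4 \<noteq> 0"
    using pow_neq_one[OF q(2), of "4*k+2"] pow_neq_one[OF q(2), of "4*k+4"]
    unfolding ex by (simp_all add: mult.commute)
  have W: "quad u (d * q ^ 6) * cubic_weight q u d k = W * ((1 - q ^ 3 * d) * quad u (d * q ^ 6 * Q ^ 3))"
    using d E' by (simp add: W_def)
  have l1: "quad u (d * q ^ 6) * cubic_term q u d k
      = W * ((1 - d * q * Q ^ 4) * quad u (d * q ^ 6 * Q ^ 3) * (1 - q ^ 3 * d))"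
    unfolding cubic_term_def ex using W by (simp add: mult_ac)
  have "(1 - q * d) * (1 - q ^ 5 * d) * cubic_term q u (d * q ^ 6) k
     = (1 - d * q ^ 7 * Q ^ 4) * ((1 - q * d) * (1 - q ^ 5 * d) * cubic_weight q u (d * q ^ 6) k)"
    unfolding cubic_term_def ex by (simp add: mult_ac eval_nat_numeral)
  also have "\<dots> = W * ((1 - d * q ^ 7 * Q ^ 4) * ((1 - d * q * Q\<^sup>2) * (1 - d * q ^ 3 * Q\<^sup>2) * (1 - d * q ^ 5 * Q\<^sup>2)))"
    unfolding cubic_weight_shift[OF d E] W_def ex by (simp add: divide_inverse mult_ac)
  finally have l2: "(1 - q * d) * (1 - q ^ 5 * d) * cubic_term q u (d * q ^ 6) k = \<dots>" .
  have r2: "wz_cert q u d k = W * (q ^ 3 * d * (quad u (d * q ^ 6 * Q ^ 3) * (1 - Q\<^sup>2) * (1 - Q\<^sup>2 / q\<^sup>2)))"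
    unfolding wz_cert_def W_def pw using d E' by (simp add: divide_inverse mult_ac)
  have div: "q ^ 4 * Q\<^sup>2 / q\<^sup>2 = q\<^sup>2 * Q\<^sup>2" using q0 by (simp add: field_simps eval_nat_numeral)
  \<comment> \<open>The two factors of the certificate at \<open>Suc k\<close> are paired with the
    inverses that come from \<open>cubic_weight_Suc\<close>, so that each pair collapses to
    1.\<close>
  have "wz_cert q u d (Suc k) = W * (q ^ 3 * d * (q\<^sup>2 * Q\<^sup>2 * quad u (q * Q) * (1 - d * q * Q\<^sup>2) * (1 - d * q ^ 3 * Q\<^sup>2)))
     * ((1 - q\<^sup>2 * Q\<^sup>2) * inverse (1 - q\<^sup>2 * Q\<^sup>2)) * ((1 - q ^ 4 * Q\<^sup>2) * inverse (1 - q ^ 4 * Q\<^sup>2))"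
    unfolding wz_cert_def W_def cubic_weight_Suc ex div by (simp add: divide_inverse mult_ac)
  then have r1: "wz_cert q u d (Suc k) = W * (q ^ 3 * d * (q\<^sup>2 * Q\<^sup>2 * quad u (q * Q) * (1 - d * q * Q\<^sup>2) * (1 - d * q ^ 3 * Q\<^sup>2)))"
    using n by (simp add: mult_ac)
  have "quad u (d * q ^ 6) * cubic_term q u d k - (1 - q * d) * (1 - q ^ 5 * d) * cubic_term q u (d * q ^ 6) k
     = W * ((1 - d * q * Q ^ 4) * quad u (d * q ^ 6 * Q ^ 3) * (1 - q ^ 3 * d)
      - (1 - d * q ^ 7 * Q ^ 4) * ((1 - d * q * Q\<^sup>2) * (1 - d * q ^ 3 * Q\<^sup>2) * (1 - d * q ^ 5 * Q\<^sup>2)))"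
    unfolding l1 l2 by (simp add: right_diff_distrib)
  also have "\<dots> = wz_cert q u d (Suc k) - wz_cert q u d k"
    unfolding wz_poly[OF q0] r1 r2 by (simp add: right_diff_distrib)
  finally show ?thesis .
qed

text \<open>
  At \<open>d = q\<^sup>-\<^sup>3\<close> only the term \<open>k = 0\<close> survives, so the limit of the certificate as \<open>d \<rightarrow> q\<^sup>-\<^sup>3\<close>
  telescopes the series at \<open>d = q\<^sup>3\<close>.
\<close>

definition base_cert :: "complex \<Rightarrow> complex \<Rightarrow> nat \<Rightarrow> complex" where
  "base_cert q u k = cubic_weight q u (q ^ 3) k * quad u (q ^ (6 * k + 3)) / (1 - q ^ (4 * k + 2))"

text \<open>At \<open>d = q ^ 3\<close> the quotient of the two \<open>qpoch\<close> factors in the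
  weight collapses to \<open>(1 - q ^ (4 * k + 2)) / (1 - q\<^sup>2)\<close>. What is left is a
  polynomial identity in which \<open>u\<close> cancels.\<close>

lemma base_identity:
  assumes q: "norm q < 1" and E: "\<And>i. quad u (q ^ (6 * i + 3)) \<noteq> 0"
  shows "cubic_term q u (q ^ 3) k = base_cert q u k - base_cert q u (Suc k)"
proof -
  define Q where "Q = q ^ (2 * k)"
  define V where "V = cubic_weight q u (q ^ 3) k / (1 - q\<^sup>2 * Q\<^sup>2)"
  have pw: "q ^ (4 * k) = Q\<^sup>2" "q ^ (6 * k) = Q ^ 3" "q ^ (8 * k) = Q ^ 4"
    by (simp_all add: Q_def power_mult[symmetric] mult.commute)
  have ex: "q ^ (4 * k + 2) = q\<^sup>2 * Q\<^sup>2" "q ^ (4 * k + 4) = q ^ 4 * Q\<^sup>2" "q ^ (2 * k + 1) = q * Q"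
    "q ^ (6 * k + 3) = q ^ 3 * Q ^ 3" "q ^ (6 * Suc k + 3) = q ^ 9 * Q ^ 3" "q ^ (8 * k + 1) = q * Q ^ 4"
    "q ^ (4 * Suc k + 2) = q ^ 6 * Q\<^sup>2"
    "q ^ 3 * q ^ (4 * k + 1) = q ^ 4 * Q\<^sup>2" "q ^ 3 * q ^ (4 * k + 3) = q ^ 6 * Q\<^sup>2"
    "q ^ 3 * q ^ (6 * k + 6) = q ^ 9 * Q ^ 3"
    by (simp_all add: power_add Q_def eval_nat_numeral mult_ac)
  have n: "1 - q\<^sup>2 * Q\<^sup>2 \<noteq> 0" "1 - q ^ 4 * Q\<^sup>2 \<noteq> 0" "1 - q ^ 6 * Q\<^sup>2 \<noteq> 0"
    using pow_neq_one[OF q, of "4*k+2"] pow_neq_one[OF q, of "4*k+4"] pow_neq_one[OF q, of "4*Suc k+2"]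
    unfolding ex by simp_all
  have e: "quad u (q ^ 9 * Q ^ 3) \<noteq> 0" using E[of "Suc k"] unfolding ex .
  have b1: "base_cert q u k = V * quad u (q ^ 3 * Q ^ 3)"
    unfolding base_cert_def V_def ex by simp
  have "base_cert q u (Suc k) = V * (q\<^sup>2 * Q\<^sup>2 * quad u (q * Q))
      * ((1 - q ^ 4 * Q\<^sup>2) * inverse (1 - q ^ 4 * Q\<^sup>2)) * ((1 - q ^ 6 * Q\<^sup>2) * inverse (1 - q ^ 6 * Q\<^sup>2))
      * (quad u (q ^ 9 * Q ^ 3) * inverse (quad u (q ^ 9 * Q ^ 3)))"
    unfolding base_cert_def V_def cubic_weight_Suc ex by (simp add: divide_inverse mult_ac)
  then have b2: "base_cert q u (Suc k) = V * (q\<^sup>2 * Q\<^sup>2 * quad u (q * Q))"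
    using n e by simp
  have t: "cubic_weight q u (q ^ 3) k = V * (1 - q\<^sup>2 * Q\<^sup>2)"
    using n by (simp add: V_def)
  have "(1 - q ^ 3 * (q * Q ^ 4)) * (1 - q\<^sup>2 * Q\<^sup>2) = quad u (q ^ 3 * Q ^ 3) - q\<^sup>2 * Q\<^sup>2 * quad u (q * Q)"
    unfolding quad_def by algebra
  then show ?thesis unfolding b1 b2 cubic_term_def ex t
    by (metis (no_types, lifting) mult.assoc mult.left_commute right_diff_distrib)
qed

section \<open>Convergence and the recurrence in \<open>d\<close>\<close>

text \<open>The square has norm at least \<open>(1 - \<rho>)\<^sup>2\<close>, and the bound on
  \<open>u\<close> lets the perturbation consume at most half of it. This fixes the disc of
  admissible \<open>u\<close> used throughout.\<close>

lemma quad_lower_bound: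
  assumes "norm y \<le> \<rho>" "\<rho> < 1" "norm u \<le> (1 - \<rho>)\<^sup>2 / 2"
  shows "(1 - \<rho>)\<^sup>2 / 2 \<le> norm (quad u y)"
proof -
  have "1 - \<rho> \<le> norm (1 - y)"
    using norm_triangle_ineq2[of 1 y] assms by simp
  then have "(1 - \<rho>)\<^sup>2 \<le> norm ((1 - y)\<^sup>2)"
    using assms by (simp add: norm_power power_mono)
  moreover have "norm (u * y) \<le> norm u"
    using assms by (simp add: norm_mult mult_left_le)
  moreover have "norm ((1 - y)\<^sup>2) - norm (u * y) \<le> norm (quad u y)"
    unfolding quad_def by (rule norm_triangle_ineq2)
  ultimately show ?thesis using assms by simp
qed

lemma quad_upper_bound:
  assumes "norm y \<le> 1" "norm u \<le> 1"
  shows "norm (quad u y) \<le> 5"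
proof -
  have "norm (1 - y) \<le> 2"
    using norm_triangle_ineq4[of 1 y] assms by simp
  then have "norm ((1 - y)\<^sup>2) \<le> 4"
    using power_mono[of "norm (1 - y)" 2 2] by (simp add: norm_power)
  moreover have "norm (u * y) \<le> 1"
    using assms by (simp add: norm_mult mult_le_one)
  moreover have "norm (quad u y) \<le> norm ((1 - y)\<^sup>2) + norm (u * y)"
    unfolding quad_def by (rule norm_triangle_ineq4)
  ultimately show ?thesis by simp
qed

section \<open>A Gaussian majorant uniform in \<open>u\<close> and \<open>d\<close>\<close>

lemma summable_gaussian:
  fixes \<rho> M :: real
  assumes "0 \<le> \<rho>" "\<rho> < 1" "0 \<le> M"
  shows "summable (\<lambda>k. \<rho> ^ (2 * k\<^sup>2) * M ^ k)"
proof (rule summable_comparison_test_ev)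
  have "(\<lambda>k. (\<rho>\<^sup>2) ^ k * M) \<longlonglongrightarrow> 0 * M"
    using assms by (intro tendsto_mult tendsto_const LIMSEQ_realpow_zero) (auto simp: power_less_one_iff)
  then have "eventually (\<lambda>k. (\<rho>\<^sup>2) ^ k * M < 1 / 2) sequentially"
    by (rule order_tendstoD) simp
  then show "eventually (\<lambda>k. norm (\<rho> ^ (2 * k\<^sup>2) * M ^ k) \<le> (1 / 2) ^ k) sequentially"
  proof eventually_elim
    case (elim k)
    \<comment> \<open>As a \<open>k\<close>-th power the term has a base tending to 0, so it is
      eventually dominated by a geometric series.\<close>
    have "\<rho> ^ (2 * k\<^sup>2) * M ^ k = ((\<rho>\<^sup>2) ^ k * M) ^ k"
      by (simp add: power_mult_distrib power_mult[symmetric] power2_eq_square mult_ac)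
        (simp add: power_add[symmetric] mult_2_right distrib_left)
    also have "\<dots> \<le> (1 / 2) ^ k"
      using elim assms by (intro power_mono) auto
    finally show ?case using assms by simp
  qed
qed (simp add: summable_geometric)

text \<open>The constant bounds the ratio of consecutive weights apart from its power of
  \<open>q\<close>: the numerator is at most \<open>5 * 2 * 2\<close> and the denominator at least
  \<open>(1 - \<rho>) ^ 4 / 2\<close>.\<close>

definition majorant :: "real \<Rightarrow> nat \<Rightarrow> real" where
  "majorant \<rho> k = \<rho> ^ (2 * k\<^sup>2) * (40 / (1 - \<rho>) ^ 4) ^ k"

lemma summable_majorant: "0 \<le> \<rho> \<Longrightarrow> \<rho> < 1 \<Longrightarrow> summable (majorant \<rho>)"
  unfolding majorant_def by (rule summable_gaussian) auto

context
  fixes q u :: complex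
  assumes q: "0 < norm q" "norm q < 1" and u: "norm u \<le> (1 - norm q)\<^sup>2 / 2"
begin

lemma norm_pow_le: "0 < n \<Longrightarrow> norm (q ^ n) \<le> norm q"
  using power_decreasing[of 1 n "norm q"] q by (simp add: norm_power)

lemma norm_dpow_le: "norm d \<le> 1 \<Longrightarrow> 0 < n \<Longrightarrow> norm (d * q ^ n) \<le> norm q"
  using norm_pow_le[of n] mult_mono[of "norm d" 1 "norm (q ^ n)" "norm q"] q by (simp add: norm_mult)

lemma quad_dpow_nonzero:
  assumes "norm d \<le> 1" "0 < n"
  shows "quad u (d * q ^ n) \<noteq> 0"
proof -
  have "0 < (1 - norm q)\<^sup>2 / 2" using q by simp
  also have "\<dots> \<le> norm (quad u (d * q ^ n))"
    by (rule quad_lower_bound[OF norm_dpow_le[OF assms] q(2) u])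
  finally show ?thesis by auto
qed

lemma norm_u_le_one: "norm u \<le> 1"
proof -
  have "(1 - norm q)\<^sup>2 \<le> 1" using q by (simp add: power_le_one)
  then show ?thesis using u by simp
qed

text \<open>Induction on \<open>k\<close> through the ratio of consecutive weights. The bound
  depends on neither \<open>u\<close> nor \<open>d\<close>, which is what both the limit
  \<open>d \<rightarrow> 0\<close> and termwise differentiation in \<open>u\<close> require.\<close>

lemma norm_cubic_weight_le:
  assumes d: "norm d \<le> 1"
  shows "norm (cubic_weight q u d k) \<le> majorant (norm q) k"
proof (induction k)
  case 0
  then show ?case by (simp add: cubic_weight_def majorant_def qpoch_def)
next
  case (Suc k)
  define \<rho> where "\<rho> = norm q"
  have r: "0 < \<rho>" "\<rho> < 1" using q by (auto simp: \<rho>_def)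
  have up: "norm (1 - d * q ^ n) \<le> 2" if "0 < n" for n
    using norm_triangle_ineq4[of 1 "d * q ^ n"] norm_dpow_le[OF d that] q by simp
  have lo: "1 - \<rho> \<le> norm (1 - q ^ n)" if "0 < n" for n
    using norm_triangle_ineq2[of 1 "q ^ n"] norm_pow_le[OF that] by (simp add: \<rho>_def)
  have "norm (quad u (q ^ (2 * k + 1))) \<le> 5"
    using norm_pow_le[of "2 * k + 1"] q by (intro quad_upper_bound norm_u_le_one) auto
  then have num: "norm (quad u (q ^ (2 * k + 1))) * norm (1 - d * q ^ (4 * k + 1)) * norm (1 - d * q ^ (4 * k + 3))
      \<le> 5 * 2 * 2"
    by (intro mult_mono up) auto
  have den: "(1 - \<rho>) * (1 - \<rho>) * ((1 - \<rho>)\<^sup>2 / 2)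
     \<le> norm (1 - q ^ (4 * k + 2)) * norm (1 - q ^ (4 * k + 4)) * norm (quad u (d * q ^ (6 * k + 6)))"
    using r quad_lower_bound[OF norm_dpow_le[OF d, of "6 * k + 6"] q(2) u]
    by (intro mult_mono lo) (auto simp: \<rho>_def)
  have "norm (quad u (q ^ (2 * k + 1))) * norm (1 - d * q ^ (4 * k + 1)) * norm (1 - d * q ^ (4 * k + 3))
       / (norm (1 - q ^ (4 * k + 2)) * norm (1 - q ^ (4 * k + 4)) * norm (quad u (d * q ^ (6 * k + 6))))
      \<le> (5 * 2 * 2) / ((1 - \<rho>) * (1 - \<rho>) * ((1 - \<rho>)\<^sup>2 / 2))"
    using r by (intro frac_le[OF _ num _ den]) auto
  also have "\<dots> = 40 / (1 - \<rho>) ^ 4"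
    by (simp add: eval_nat_numeral)
  finally have "norm (cubic_weight q u d k) * (\<rho> ^ (4 * k + 2) *
      (norm (quad u (q ^ (2 * k + 1))) * norm (1 - d * q ^ (4 * k + 1)) * norm (1 - d * q ^ (4 * k + 3))
       / (norm (1 - q ^ (4 * k + 2)) * norm (1 - q ^ (4 * k + 4)) * norm (quad u (d * q ^ (6 * k + 6))))))
     \<le> majorant \<rho> k * (\<rho> ^ (4 * k + 2) * (40 / (1 - \<rho>) ^ 4))"
    using r Suc.IH by (intro mult_mono) (auto simp: \<rho>_def majorant_def)
  also have "\<dots> = majorant \<rho> (Suc k)"
  proof -
    have "2 * (Suc k)\<^sup>2 = 2 * k\<^sup>2 + (4 * k + 2)"
      by (simp add: power2_eq_square algebra_simps)
    then show ?thesis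
      unfolding majorant_def power_Suc by (simp only: power_add mult_ac)
  qed
  finally show ?case
    unfolding cubic_weight_Suc norm_mult norm_divide norm_power \<rho>_def by (simp only: times_divide_eq_right mult.assoc)
qed

lemma norm_cubic_term_le:
  assumes d: "norm d \<le> 1"
  shows "norm (cubic_term q u d k) \<le> 2 * majorant (norm q) k"
proof -
  have "norm (1 - d * q ^ (8 * k + 1)) \<le> 2"
    using norm_triangle_ineq4[of 1 "d * q ^ (8 * k + 1)"] norm_dpow_le[OF d, of "8 * k + 1"] q by simp
  then show ?thesis unfolding cubic_term_def norm_mult
    by (intro mult_mono norm_cubic_weight_le d) auto
qed

lemma summable_cubic_term: "norm d \<le> 1 \<Longrightarrow> summable (cubic_term q u d)"
  by (rule summable_comparison_test'[OF summable_mult[OF summable_majorant] norm_cubic_term_le])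
    (use q in auto)

lemma cubic_weight_tendsto_0:
  assumes "norm d \<le> 1"
  shows "cubic_weight q u d \<longlonglongrightarrow> 0"
proof (rule tendsto_norm_zero_cancel, rule tendsto_sandwich[where f = "\<lambda>_. 0"])
  show "majorant (norm q) \<longlonglongrightarrow> 0"
    using q by (intro summable_LIMSEQ_zero summable_majorant) auto
qed (auto intro!: always_eventually norm_cubic_weight_le assms)

lemma pow_lin_tendsto_0: "0 < a \<Longrightarrow> (\<lambda>k. q ^ (a * k + b)) \<longlonglongrightarrow> 0"
proof -
  assume "0 < a"
  then have "(\<lambda>k. (q ^ a) ^ k * q ^ b) \<longlonglongrightarrow> 0 * q ^ b"
    using pow_less_one[OF q(2)] by (intro tendsto_mult tendsto_const LIMSEQ_power_zero) auto
  then show ?thesis by (simp add: power_add power_mult)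
qed

lemma wz_cert_tendsto_0:
  assumes "norm d \<le> 1"
  shows "wz_cert q u d \<longlonglongrightarrow> 0"
proof -
  \<comment> \<open>The exponents are written with \<open>+ 0\<close> to match
    \<open>pow_lin_tendsto_0\<close>.\<close>
  have "(\<lambda>k. quad u (d * q ^ 6) * (q ^ 3 * d / (1 - q ^ 3 * d)) * cubic_weight q u d k
       * (1 - q ^ (4 * k + 0)) * (1 - q ^ (4 * k + 0) / q\<^sup>2)) \<longlonglongrightarrow>
      quad u (d * q ^ 6) * (q ^ 3 * d / (1 - q ^ 3 * d)) * 0 * (1 - 0) * (1 - 0 / q\<^sup>2)"
    using q by (intro tendsto_intros cubic_weight_tendsto_0 assms pow_lin_tendsto_0) auto
  then show ?thesis by (simp add: wz_cert_def[abs_def])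
qed

lemma base_cert_tendsto_0: "base_cert q u \<longlonglongrightarrow> 0"
proof -
  have "(\<lambda>k. cubic_weight q u (q ^ 3) k * ((1 - q ^ (6 * k + 3))\<^sup>2 - u * q ^ (6 * k + 3)) / (1 - q ^ (4 * k + 2)))
      \<longlonglongrightarrow> 0 * ((1 - 0)\<^sup>2 - u * 0) / (1 - 0)"
    using q pow_less_one[OF q(2), of 3]
    by (intro tendsto_intros cubic_weight_tendsto_0 pow_lin_tendsto_0) auto
  then show ?thesis by (simp add: base_cert_def[abs_def] quad_def)
qed

section \<open>The recurrence in \<open>d\<close>, its telescoping base case and its
  iteration\<close>

text \<open>Summing the WZ identity over \<open>k\<close> leaves nothing on the right, since the
  certificate vanishes at \<open>k = 0\<close> and tends to 0.\<close>

lemma cubic_sum_shift: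
  assumes d: "norm d \<le> 1"
  shows "quad u (d * q ^ 6) * suminf (cubic_term q u d)
       = (1 - q * d) * (1 - q ^ 5 * d) * suminf (cubic_term q u (d * q ^ 6))"
proof -
  have d6: "norm (d * q ^ 6) \<le> 1" using norm_dpow_le[OF d, of 6] q by simp
  have "norm (q ^ 3 * d) < 1" using norm_dpow_le[OF d, of 3] q by (simp add: mult.commute)
  then have d3: "1 - q ^ 3 * d \<noteq> 0" by auto
  have "(\<lambda>k. wz_cert q u d (Suc k) - wz_cert q u d k) sums (0 - wz_cert q u d 0)"
    by (rule telescope_sums[OF wz_cert_tendsto_0[OF d]])
  moreover have "wz_cert q u d 0 = 0" by (simp add: wz_cert_def)
  ultimately have "(\<lambda>k. quad u (d * q ^ 6) * cubic_term q u d k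
       - (1 - q * d) * (1 - q ^ 5 * d) * cubic_term q u (d * q ^ 6) k) sums 0"
    by (subst wz_identity[OF q d3 quad_dpow_nonzero[OF d]]) auto
  moreover have "(\<lambda>k. quad u (d * q ^ 6) * cubic_term q u d k
       - (1 - q * d) * (1 - q ^ 5 * d) * cubic_term q u (d * q ^ 6) k) sums
       (quad u (d * q ^ 6) * suminf (cubic_term q u d)
       - (1 - q * d) * (1 - q ^ 5 * d) * suminf (cubic_term q u (d * q ^ 6)))"
    by (intro sums_diff sums_mult summable_sums summable_cubic_term d d6)
  ultimately show ?thesis using sums_unique2 by fastforce
qed

lemma cubic_sum_base: "suminf (cubic_term q u (q ^ 3)) = quad u (q ^ 3) / (1 - q\<^sup>2)"
proof -
  have E: "quad u (q ^ (6 * i + 3)) \<noteq> 0" for i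
    using quad_dpow_nonzero[of 1 "6 * i + 3"] by simp
  have "(\<lambda>k. base_cert q u k - base_cert q u (Suc k)) sums (base_cert q u 0 - 0)"
    by (rule telescope_sums'[OF base_cert_tendsto_0])
  then have "cubic_term q u (q ^ 3) sums base_cert q u 0"
    by (simp add: base_identity[OF q(2) E, symmetric])
  then show ?thesis
    by (simp add: sums_iff base_cert_def cubic_weight_def qpoch_def power2_eq_square)
qed

lemma cubic_sum_iterate:
  assumes d: "norm d \<le> 1"
  shows "(\<Prod>n<N. quad u (d * q ^ (6 * n + 6))) * suminf (cubic_term q u d)
     = qpoch (q * d) (q ^ 6) N * qpoch (q ^ 5 * d) (q ^ 6) N * suminf (cubic_term q u (d * q ^ (6 * N)))"
proof (induction N)
  case 0
  then show ?case by (simp add: qpoch_def)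
next
  case (Suc N)
  have dN: "norm (d * q ^ (6 * N)) \<le> 1"
    using norm_dpow_le[OF d, of "6 * N"] d q by (cases "N = 0") auto
  have "(\<Prod>n<Suc N. quad u (d * q ^ (6 * n + 6))) * suminf (cubic_term q u d)
     = quad u (d * q ^ (6 * N) * q ^ 6) * ((\<Prod>n<N. quad u (d * q ^ (6 * n + 6))) * suminf (cubic_term q u d))"
    by (simp add: power_add mult_ac)
  also have "\<dots> = qpoch (q * d) (q ^ 6) N * qpoch (q ^ 5 * d) (q ^ 6) N *
      (quad u (d * q ^ (6 * N) * q ^ 6) * suminf (cubic_term q u (d * q ^ (6 * N))))"
    unfolding Suc.IH by (simp add: mult_ac)
  also have "\<dots> = qpoch (q * d) (q ^ 6) (Suc N) * qpoch (q ^ 5 * d) (q ^ 6) (Suc N)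
      * suminf (cubic_term q u (d * q ^ (6 * Suc N)))"
    unfolding cubic_sum_shift[OF dN]
    by (simp add: qpoch_Suc power_mult[symmetric] power_add mult_ac)
  finally show ?case .
qed

text \<open>Tannery's theorem: each term is continuous in \<open>d\<close> at 0, and the majorant is
  independent of \<open>d\<close>.\<close>

lemma cubic_sum_tendsto:
  assumes d: "norm d \<le> 1"
  shows "(\<lambda>N. suminf (cubic_term q u (d * q ^ (6 * N)))) \<longlonglongrightarrow> suminf (cubic_term q u 0)"
proof -
  have dN: "norm (d * q ^ (6 * N)) \<le> 1" for N
    using norm_dpow_le[OF d, of "6 * N"] d q by (cases "N = 0") auto
  have "(\<lambda>N. d * q ^ (6 * N + 0)) \<longlonglongrightarrow> d * 0"
    by (intro tendsto_intros pow_lin_tendsto_0) auto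
  then have D: "(\<lambda>N. d * q ^ (6 * N)) \<longlonglongrightarrow> 0" by simp
  have "(\<lambda>N. cubic_term q u (d * q ^ (6 * N)) k) \<longlonglongrightarrow> cubic_term q u 0 k" for k
  proof -
    have nz: "qpoch (q\<^sup>2) (q\<^sup>2) (2 * k) \<noteq> 0"
      using pow_less_one[OF q(2), of 2] by (intro qpoch_nonzero) auto
    have "isCont (\<lambda>e. \<Prod>i<k. quad u (e * q ^ (6 * i + 6))) 0" "isCont (\<lambda>e. qpoch (q * e) (q\<^sup>2) (2 * k)) 0"
      unfolding quad_def qpoch_def by (intro continuous_intros)+
    then have c: "isCont (\<lambda>e. cubic_term q u e k) 0"
      unfolding cubic_term_def cubic_weight_def
      using nz by (intro isCont_diff isCont_mult isCont_divide continuous_const continuous_ident)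
        (simp_all add: quad_def)
    with D show ?thesis using isCont_tendsto_compose by blast
  qed
  then show ?thesis
  proof (rule tannerys_theorem[THEN conjunct2, THEN conjunct2])
    show "\<forall>\<^sub>F (k, N) in sequentially \<times>\<^sub>F sequentially.
        norm (cubic_term q u (d * q ^ (6 * N)) k) \<le> 2 * majorant (norm q) k"
      using norm_cubic_term_le[OF dN] by (intro always_eventually) auto
    show "summable (\<lambda>k. 2 * majorant (norm q) k)"
      using q by (intro summable_mult summable_majorant) auto
  qed simp
qed

end

section \<open>Infinite products and their derivatives\<close>

lemma tendsto_prodinf:
  fixes f :: "nat \<Rightarrow> complex"
  assumes "summable (\<lambda>n. norm (f n - 1))"
  shows "(\<lambda>N. \<Prod>n<N. f n) \<longlonglongrightarrow> prodinf f"
  using assms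
  by (subst LIMSEQ_lessThan_iff_atMost)
    (intro convergent_prod_LIMSEQ abs_convergent_prod_imp_convergent_prod summable_imp_abs_convergent_prod)

lemma summable_geometric_terms:
  fixes q x :: complex
  assumes "norm q < 1"
  shows "summable (\<lambda>n. norm (x * q ^ n))"
  using assms by (simp add: norm_mult norm_power summable_geometric summable_mult)

lemma qpoch_tendsto:
  assumes "norm q < 1"
  shows "qpoch x q \<longlonglongrightarrow> qpoch_inf x q"
  using tendsto_prodinf[of "\<lambda>i. 1 - x * q ^ i"] summable_geometric_terms[OF assms]
  unfolding qpoch_def[abs_def] qpoch_inf_def by simp

lemma qpoch_inf_nonzero:
  assumes "norm q < 1" "norm x < 1"
  shows "qpoch_inf x q \<noteq> 0"
proof -
  have "convergent_prod (\<lambda>i. 1 - x * q ^ i)"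
    using summable_geometric_terms[OF assms(1), of x]
    by (intro abs_convergent_prod_imp_convergent_prod summable_imp_abs_convergent_prod) simp
  moreover have "1 - x * q ^ i \<noteq> 0" for i
    using norm_geometric_term_less[OF assms, of i] by auto
  ultimately show ?thesis unfolding qpoch_inf_def by (rule prodinf_nonzero)
qed

lemma qpoch_inf_head:
  assumes "norm q < 1"
  shows "qpoch_inf x q = (1 - x) * qpoch_inf (x * q) q"
proof (rule LIMSEQ_unique)
  show "(\<lambda>n. qpoch x q (Suc n)) \<longlonglongrightarrow> qpoch_inf x q"
    using qpoch_tendsto[OF assms] by (rule LIMSEQ_Suc)
  show "(\<lambda>n. qpoch x q (Suc n)) \<longlonglongrightarrow> (1 - x) * qpoch_inf (x * q) q"
    unfolding qpoch_Suc_shift by (intro tendsto_intros qpoch_tendsto assms)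
qed

text \<open>The factors are sorted by their index modulo 3. This later rewrites products in base
  \<open>q\<^sup>2\<close> in base \<open>q ^ 6\<close>.\<close>

lemma qpoch_inf_trisect:
  assumes "norm q < 1"
  shows "qpoch_inf x q = qpoch_inf x (q ^ 3) * qpoch_inf (x * q) (q ^ 3) * qpoch_inf (x * q\<^sup>2) (q ^ 3)"
proof (rule LIMSEQ_unique)
  have fin: "qpoch x q (3 * N) = qpoch x (q ^ 3) N * qpoch (x * q) (q ^ 3) N * qpoch (x * q\<^sup>2) (q ^ 3) N" for N
  proof (induction N)
    case 0
    then show ?case by (simp add: qpoch_def)
  next
    case (Suc N)
    have "qpoch x q (3 * Suc N) = qpoch x q (3 * N) *
      ((1 - x * q ^ (3 * N)) * (1 - x * q ^ (3 * N + 1)) * (1 - x * q ^ (3 * N + 2)))"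
      by (simp add: eval_nat_numeral qpoch_Suc mult_ac)
    then show ?case
      unfolding Suc.IH qpoch_Suc power_mult[symmetric] by (simp add: power_add power2_eq_square mult_ac)
  qed
  show "(\<lambda>N. qpoch x q (3 * N)) \<longlonglongrightarrow> qpoch_inf x q"
    using LIMSEQ_subseq_LIMSEQ[OF qpoch_tendsto[OF assms], of "\<lambda>N. 3 * N"]
    by (simp add: o_def strict_mono_def)
  show "(\<lambda>N. qpoch x q (3 * N)) \<longlonglongrightarrow>
     qpoch_inf x (q ^ 3) * qpoch_inf (x * q) (q ^ 3) * qpoch_inf (x * q\<^sup>2) (q ^ 3)"
    unfolding fin by (intro tendsto_intros qpoch_tendsto pow_less_one assms) auto
qed

lemma norm_quad_minus_one_le:
  assumes "norm y \<le> 1" "norm u \<le> 1"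
  shows "norm (quad u y - 1) \<le> 4 * norm y"
proof -
  have "norm (y - 2 - u) \<le> norm y + 2 + norm u"
    using norm_triangle_ineq4[of "y - 2" u] norm_triangle_ineq4[of y 2] by simp
  then have "norm (y - 2 - u) * norm y \<le> 4 * norm y"
    using assms by (intro mult_right_mono) auto
  moreover have "quad u y - 1 = (y - 2 - u) * y"
    by (simp add: quad_def power2_eq_square algebra_simps)
  ultimately show ?thesis by (simp add: norm_mult)
qed

lemma tendsto_prodinf_quad:
  assumes "summable (\<lambda>n. norm (y n))" "\<And>n. norm (y n) \<le> 1" "norm u \<le> 1"
  shows "(\<lambda>N. \<Prod>n<N. quad u (y n)) \<longlonglongrightarrow> (\<Prod>n. quad u (y n))"
proof (rule tendsto_prodinf)
  show "summable (\<lambda>n. norm (quad u (y n) - 1))"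
    by (rule summable_comparison_test'[OF summable_mult[OF assms(1), of 4]])
      (simp add: norm_quad_minus_one_le assms)
qed

text \<open>Logarithmic differentiation: \<open>quad u y\<close> has \<open>u\<close>-derivative
  \<open>- y\<close> and value \<open>(1 - y)\<^sup>2\<close> at \<open>u = 0\<close>.\<close>

lemma prod_quad_deriv_0:
  fixes y :: "nat \<Rightarrow> complex"
  assumes "\<And>i. y i \<noteq> 1"
  shows "((\<lambda>u. \<Prod>i<n. quad u (y i)) has_field_derivative
     - (\<Prod>i<n. quad 0 (y i)) * (\<Sum>i<n. y i / (1 - y i)\<^sup>2)) (at 0)"
proof (induction n)
  case 0
  then show ?case by simp
next
  case (Suc n)
  have "((\<lambda>u. quad u (y n)) has_field_derivative - y n) (at 0)"
    unfolding quad_def by (auto intro!: derivative_eq_intros)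
  from DERIV_mult[OF Suc.IH this]
  have "((\<lambda>u. \<Prod>i<Suc n. quad u (y i)) has_field_derivative
      - (\<Prod>i<n. quad 0 (y i)) * (\<Sum>i<n. y i / (1 - y i)\<^sup>2) * quad 0 (y n)
      + - y n * (\<Prod>i<n. quad 0 (y i))) (at 0)"
    by simp
  moreover define w where "w = y n / (1 - y n)\<^sup>2"
  have "y n = quad 0 (y n) * w"
    using assms[of n] by (simp add: quad_def w_def)
  then have "- (\<Prod>i<n. quad 0 (y i)) * (\<Sum>i<n. y i / (1 - y i)\<^sup>2) * quad 0 (y n)
      + - y n * (\<Prod>i<n. quad 0 (y i))
      = - (\<Prod>i<Suc n. quad 0 (y i)) * (\<Sum>i<Suc n. y i / (1 - y i)\<^sup>2)"
    unfolding prod.lessThan_Suc sum.lessThan_Suc w_def[symmetric] by algebra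
  ultimately show ?case by simp
qed

lemma summable_log_deriv:
  fixes y :: "nat \<Rightarrow> complex"
  assumes "summable (\<lambda>n. norm (y n))"
  shows "summable (\<lambda>n. norm (y n / (1 - y n)\<^sup>2))"
proof (rule summable_comparison_test_ev)
  have "(\<lambda>n. norm (y n)) \<longlonglongrightarrow> 0" by (rule summable_LIMSEQ_zero[OF assms])
  then have "eventually (\<lambda>n. norm (y n) < 1 / 2) sequentially" by (rule order_tendstoD) simp
  then show "eventually (\<lambda>n. norm (norm (y n / (1 - y n)\<^sup>2)) \<le> 4 * norm (y n)) sequentially"
  proof eventually_elim
    case (elim n)
    have "1 / 2 \<le> norm (1 - y n)" using norm_triangle_ineq2[of 1 "y n"] elim by simp
    then have "(1 / 2)\<^sup>2 \<le> (norm (1 - y n))\<^sup>2" by (intro power_mono) auto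
    then have "norm (y n) / (norm (1 - y n))\<^sup>2 \<le> norm (y n) / (1 / 2)\<^sup>2"
      by (intro divide_left_mono mult_pos_pos) (auto simp: power2_eq_square)
    then show ?case by (simp add: norm_divide norm_mult power2_eq_square)
  qed
qed (use assms in \<open>simp add: summable_mult\<close>)

text \<open>The product is rewritten as the series of increments of its partial products. These are
  holomorphic and uniformly dominated on the unit disc, so the series may be differentiated
  termwise, and the derivatives telescope again.\<close>

lemma prodinf_quad_deriv_0:
  assumes sum: "summable (\<lambda>n. norm (y n))" and y: "\<And>n. norm (y n) < 1"
  shows "((\<lambda>u. \<Prod>n. quad u (y n)) has_field_derivative
     - (\<Prod>n. quad 0 (y n)) * (\<Sum>n. y n / (1 - y n)\<^sup>2)) (at 0)"
proof -
  define P where "P n u = (\<Prod>i<n. quad u (y i))" for n u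
  define f where "f n u = P (Suc n) u - P n u" for n u
  \<comment> \<open>Bounds every partial product on the unit disc, through
    \<open>1 + t \<le> exp t\<close> applied to factors of norm at most
    \<open>1 + 4 * norm (y i)\<close>.\<close>
  define C where "C = exp (4 * (\<Sum>n. norm (y n)))"
  have y1: "y n \<noteq> 1" for n using y[of n] by auto
  have ball: "norm u \<le> 1" if "u \<in> ball 0 1" for u :: complex using that by simp
  have P_lim: "(\<lambda>n. P n u) \<longlonglongrightarrow> (\<Prod>n. quad u (y n))" if "u \<in> ball 0 1" for u
    unfolding P_def using sum y ball[OF that] by (intro tendsto_prodinf_quad) (auto simp: less_imp_le)
  have P_le: "norm (P n u) \<le> C" if "u \<in> ball 0 1" for n u
  proof -
    have "norm (quad u (y i)) \<le> 1 + 4 * norm (y i)" for i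
      using norm_quad_minus_one_le[of "y i" u] y[of i] ball[OF that]
        norm_triangle_ineq2[of "quad u (y i)" 1] by simp
    then have "norm (P n u) \<le> (\<Prod>i<n. 1 + 4 * norm (y i))"
      unfolding P_def prod_norm[symmetric] by (intro prod_mono) auto
    also have "\<dots> \<le> exp (\<Sum>i<n. 4 * norm (y i))" by (rule prod_le_exp_sum) simp
    also have "\<dots> \<le> C"
      unfolding C_def using sum by (simp add: sum_distrib_left[symmetric] sum_le_suminf)
    finally show ?thesis .
  qed
  have hol: "f n holomorphic_on ball 0 1" for n
    unfolding f_def[abs_def] P_def quad_def by (intro holomorphic_intros)
  have f_le: "norm (f n u) \<le> C * (4 * norm (y n))" if "u \<in> ball 0 1" for n u
  proof -
    have "f n u = P n u * (quad u (y n) - 1)" by (simp add: f_def P_def algebra_simps)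
    then show ?thesis
      using P_le[OF that] norm_quad_minus_one_le[of "y n" u] y[of n] ball[OF that]
      by (simp add: norm_mult) (intro mult_mono, auto simp: C_def)
  qed
  obtain g g' where g: "\<forall>u\<in>ball 0 1. (\<lambda>n. f n u) sums g u \<and> (\<lambda>n. deriv (f n) u) sums g' u
      \<and> (g has_field_derivative g' u) (at u)"
  proof (rule series_and_derivative_comparison[of "ball 0 (1::real)" "\<lambda>n. C * (4 * norm (y n))" f "\<lambda>n. deriv (f n)"])
    show "summable (\<lambda>n. C * (4 * norm (y n)))" using sum by (intro summable_mult)
    show "(f n has_field_derivative deriv (f n) x) (at x)" if "x \<in> ball 0 1" for n x
      using hol that by (intro holomorphic_derivI) auto
  qed (use f_le in auto)
  \<comment> \<open>The summand 1 is the empty product \<open>P 0 u\<close>, where the telescoping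
    starts.\<close>
  have g_eq: "(\<Prod>n. quad u (y n)) = g u + 1" if "u \<in> ball 0 1" for u
  proof -
    have "(\<lambda>n. f n u) sums ((\<Prod>n. quad u (y n)) - P 0 u)"
      unfolding f_def by (rule telescope_sums[OF P_lim[OF that]])
    moreover have "(\<lambda>n. f n u) sums g u" using g that by auto
    ultimately have "(\<Prod>n. quad u (y n)) - P 0 u = g u" by (rule sums_unique2)
    then show ?thesis by (simp add: P_def algebra_simps)
  qed
  \<comment> \<open>The derivatives at 0 of the partial products. \<open>D 0\<close> vanishes, so
    the telescoped series gives the limit of \<open>D\<close> itself.\<close>
  define D where "D n = - P n 0 * (\<Sum>i<n. y i / (1 - y i)\<^sup>2)" for n
  have dP: "(P n has_field_derivative D n) (at 0)" for n
    using prod_quad_deriv_0[of y, OF y1] unfolding P_def D_def .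
  have "deriv (f n) 0 = D (Suc n) - D n" for n
    unfolding f_def by (intro DERIV_imp_deriv DERIV_diff dP)
  moreover have "D \<longlonglongrightarrow> - (\<Prod>n. quad 0 (y n)) * (\<Sum>n. y n / (1 - y n)\<^sup>2)"
    unfolding D_def using P_lim[of 0]
    by (intro tendsto_intros summable_LIMSEQ summable_norm_cancel[OF summable_log_deriv] sum) auto
  ultimately have "(\<lambda>n. deriv (f n) 0) sums (- (\<Prod>n. quad 0 (y n)) * (\<Sum>n. y n / (1 - y n)\<^sup>2) - D 0)"
    by (simp only: telescope_sums)
  moreover have "(\<lambda>n. deriv (f n) 0) sums g' 0" using g by auto
  ultimately have "g' 0 = - (\<Prod>n. quad 0 (y n)) * (\<Sum>n. y n / (1 - y n)\<^sup>2)"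
    using sums_unique2 by (fastforce simp: D_def)
  then have "((\<lambda>u. g u + 1) has_field_derivative - (\<Prod>n. quad 0 (y n)) * (\<Sum>n. y n / (1 - y n)\<^sup>2)) (at 0)"
    using g by (auto intro!: derivative_eq_intros)
  then show ?thesis
    by (rule has_field_derivative_transform_within_open[where S = "ball 0 1"]) (auto simp: g_eq)
qed

lemma prodinf_quad_0:
  assumes "norm q < 1" "norm x < 1"
  shows "(\<Prod>n. quad 0 (x * q ^ n)) = (qpoch_inf x q)\<^sup>2"
proof (rule LIMSEQ_unique)
  show "(\<lambda>N. \<Prod>n<N. quad 0 (x * q ^ n)) \<longlonglongrightarrow> (\<Prod>n. quad 0 (x * q ^ n))"
    using norm_geometric_term_less[OF assms] summable_geometric_terms[OF assms(1)]
    by (intro tendsto_prodinf_quad) (auto simp: less_imp_le)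
  have "(\<lambda>N. (qpoch x q N)\<^sup>2) \<longlonglongrightarrow> (qpoch_inf x q)\<^sup>2"
    by (intro tendsto_intros qpoch_tendsto assms)
  then show "(\<lambda>N. \<Prod>n<N. quad 0 (x * q ^ n)) \<longlonglongrightarrow> (qpoch_inf x q)\<^sup>2"
    by (simp add: qpoch_def quad_def prod_power_distrib)
qed

section \<open>The product evaluation and its derivative\<close>

text \<open>The limit \<open>N \<rightarrow> \<infinity>\<close> in
  \<open>cubic_sum_iterate\<close>.\<close>

lemma cubic_sum_limit:
  assumes q: "0 < norm q" "norm q < 1" and u: "norm u \<le> (1 - norm q)\<^sup>2 / 2" and d: "norm d \<le> 1"
  shows "(\<Prod>n. quad u (d * q ^ 6 * (q ^ 6) ^ n)) * suminf (cubic_term q u d)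
     = qpoch_inf (q * d) (q ^ 6) * qpoch_inf (q ^ 5 * d) (q ^ 6) * suminf (cubic_term q u 0)"
proof (rule LIMSEQ_unique)
  have d6: "norm (d * q ^ 6) < 1" using norm_dpow_le[OF q u d, of 6] q by simp
  have q6: "norm (q ^ 6) < 1" using pow_less_one[OF q(2), of 6] by simp
  have "(\<lambda>N. \<Prod>n<N. quad u (d * q ^ 6 * (q ^ 6) ^ n)) \<longlonglongrightarrow> (\<Prod>n. quad u (d * q ^ 6 * (q ^ 6) ^ n))"
    using norm_geometric_term_less[OF q6 d6] summable_geometric_terms[OF q6] norm_u_le_one[OF q u]
    by (intro tendsto_prodinf_quad) (auto simp: less_imp_le)
  then show "(\<lambda>N. (\<Prod>n<N. quad u (d * q ^ 6 * (q ^ 6) ^ n)) * suminf (cubic_term q u d)) \<longlonglongrightarrow>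
     (\<Prod>n. quad u (d * q ^ 6 * (q ^ 6) ^ n)) * suminf (cubic_term q u d)"
    by (intro tendsto_intros)
  have e: "(\<Prod>n<N. quad u (d * q ^ 6 * (q ^ 6) ^ n)) = (\<Prod>n<N. quad u (d * q ^ (6 * n + 6)))" for N
    by (simp add: power_add power_mult[symmetric] mult_ac)
  show "(\<lambda>N. (\<Prod>n<N. quad u (d * q ^ 6 * (q ^ 6) ^ n)) * suminf (cubic_term q u d)) \<longlonglongrightarrow>
     qpoch_inf (q * d) (q ^ 6) * qpoch_inf (q ^ 5 * d) (q ^ 6) * suminf (cubic_term q u 0)"
    unfolding e cubic_sum_iterate[OF q u d]
    by (intro tendsto_intros qpoch_tendsto q6 cubic_sum_tendsto[OF q u d])
qed

lemma prodinf_quad_head: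
  assumes "norm q < 1" "norm x < 1" "norm u \<le> 1"
  shows "(\<Prod>n. quad u (x * q ^ n)) = quad u x * (\<Prod>n. quad u (x * q * q ^ n))"
proof (rule LIMSEQ_unique)
  have lim: "(\<lambda>N. \<Prod>n<N. quad u (z * q ^ n)) \<longlonglongrightarrow> (\<Prod>n. quad u (z * q ^ n))" if "norm z < 1" for z
    using norm_geometric_term_less[OF assms(1) that] summable_geometric_terms[OF assms(1)] assms(3)
    by (intro tendsto_prodinf_quad) (auto simp: less_imp_le)
  show "(\<lambda>N. \<Prod>n<Suc N. quad u (x * q ^ n)) \<longlonglongrightarrow> (\<Prod>n. quad u (x * q ^ n))"
    using lim[OF assms(2)] by (rule LIMSEQ_Suc)
  have "norm (x * q) < 1" using norm_geometric_term_less[OF assms(1,2), of 1] by simp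
  then have "(\<lambda>N. quad u x * (\<Prod>n<N. quad u (x * q * q ^ n))) \<longlonglongrightarrow> quad u x * (\<Prod>n. quad u (x * q * q ^ n))"
    by (intro tendsto_intros lim)
  then show "(\<lambda>N. \<Prod>n<Suc N. quad u (x * q ^ n)) \<longlonglongrightarrow> quad u x * (\<Prod>n. quad u (x * q * q ^ n))"
    by (subst prod.lessThan_Suc_shift) (simp add: mult_ac)
qed

text \<open>The cases \<open>d = 1\<close> and \<open>d = q ^ 3\<close> of
  \<open>cubic_sum_limit\<close> share the unknown value at \<open>d = 0\<close>. It is eliminated
  by cross-multiplication, so it need not be known to be nonzero.\<close>

lemma cubic_summation:
  assumes q: "0 < norm q" "norm q < 1" and u: "norm u \<le> (1 - norm q)\<^sup>2 / 2"
  shows "qpoch_inf (q\<^sup>2) (q ^ 6) * qpoch_inf (q ^ 4) (q ^ 6)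
       * (\<Prod>n. quad u (q ^ 6 * (q ^ 6) ^ n)) * suminf (cubic_term q u 1)
     = qpoch_inf q (q ^ 6) * qpoch_inf (q ^ 5) (q ^ 6) * (\<Prod>n. quad u (q ^ 3 * (q ^ 6) ^ n))"
proof -
  let ?L = "suminf (cubic_term q u 0)"
  have q6: "norm (q ^ 6) < 1" "norm (q ^ 3) < 1" "q\<^sup>2 \<noteq> 1"
    using pow_less_one[OF q(2)] pow_neq_one[OF q(2)] by auto
  have 1: "(\<Prod>n. quad u (q ^ 6 * (q ^ 6) ^ n)) * suminf (cubic_term q u 1)
     = qpoch_inf q (q ^ 6) * qpoch_inf (q ^ 5) (q ^ 6) * ?L"
    using cubic_sum_limit[OF q u, of 1] by simp
  have ex: "q * q ^ 3 = q ^ 4" "q ^ 5 * q ^ 3 = q\<^sup>2 * q ^ 6"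
    by (simp_all add: eval_nat_numeral mult_ac)
  have 2: "(\<Prod>n. quad u (q ^ 3 * q ^ 6 * (q ^ 6) ^ n)) * (quad u (q ^ 3) / (1 - q\<^sup>2))
     = qpoch_inf (q ^ 4) (q ^ 6) * qpoch_inf (q\<^sup>2 * q ^ 6) (q ^ 6) * ?L"
    using cubic_sum_limit[OF q u, of "q ^ 3"] q6 unfolding cubic_sum_base[OF q u] ex
    by (simp add: less_imp_le)
  \<comment> \<open>The base value \<open>quad u (q ^ 3) / (1 - q\<^sup>2)\<close> supplies exactly
    the missing head factors of the two products that start one step late.\<close>
  have "(\<Prod>n. quad u (q ^ 3 * (q ^ 6) ^ n)) = qpoch_inf (q\<^sup>2) (q ^ 6) * qpoch_inf (q ^ 4) (q ^ 6) * ?L"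
    unfolding prodinf_quad_head[OF q6(1,2) norm_u_le_one[OF q u]] qpoch_inf_head[OF q6(1), of "q\<^sup>2"]
    using 2 q6 by (simp add: field_simps)
  then show ?thesis using 1 by (simp add: mult_ac)
qed

section \<open>Differentiating the series in \<open>u\<close> at 0\<close>

lemma cubic_term_holomorphic:
  assumes q: "0 < norm q" "norm q < 1"
  shows "(\<lambda>u. cubic_term q u 1 k) holomorphic_on ball 0 ((1 - norm q)\<^sup>2 / 2)"
proof -
  have nz: "qpoch (q\<^sup>2) (q\<^sup>2) (2 * k) * (\<Prod>i<k. (1 - 1 * q ^ (6 * i + 6))\<^sup>2 - u * (1 * q ^ (6 * i + 6))) \<noteq> 0"
    if "u \<in> ball 0 ((1 - norm q)\<^sup>2 / 2)" for u
  proof -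
    have u: "norm u \<le> (1 - norm q)\<^sup>2 / 2" using that by simp
    have "qpoch (q\<^sup>2) (q\<^sup>2) (2 * k) \<noteq> 0"
      using pow_less_one[OF q(2), of 2] by (intro qpoch_nonzero) auto
    moreover have "(\<Prod>i<k. quad u (1 * q ^ (6 * i + 6))) \<noteq> 0"
      using quad_dpow_nonzero[OF q u, of 1] by simp
    ultimately show ?thesis unfolding quad_def by simp
  qed
  show ?thesis
    unfolding cubic_term_def cubic_weight_def quad_def
    by (intro holomorphic_intros nz)
qed

text \<open>Only the two products of \<open>quad\<close> factors depend on \<open>u\<close>. The
  difference of their logarithmic derivatives produces the inner sum of the theorem, up to sign and
  the factors of \<open>1 - q\<close> in the \<open>q\<close>-integers.\<close>

lemma cubic_term_deriv_0:
  assumes q: "norm q < 1"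
  shows "((\<lambda>u. cubic_term q u 1 k) has_field_derivative
     - cubic_term q 0 1 k * (\<Sum>i<k. q ^ (2 * i + 1) / (1 - q ^ (2 * i + 1))\<^sup>2
        - q ^ (6 * i + 6) / (1 - q ^ (6 * i + 6))\<^sup>2)) (at 0)"
proof -
  let ?N = "\<lambda>u. \<Prod>i<k. quad u (q ^ (2 * i + 1))"
  let ?E = "\<lambda>u. \<Prod>i<k. quad u (q ^ (6 * i + 6))"
  let ?a = "\<Sum>i<k. q ^ (2 * i + 1) / (1 - q ^ (2 * i + 1))\<^sup>2"
  let ?b = "\<Sum>i<k. q ^ (6 * i + 6) / (1 - q ^ (6 * i + 6))\<^sup>2"
  define c where "c = (1 - q ^ (8 * k + 1)) * (q ^ (2 * k\<^sup>2) * qpoch q (q\<^sup>2) (2 * k) / qpoch (q\<^sup>2) (q\<^sup>2) (2 * k))"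
  have n1: "q ^ n \<noteq> 1" if "0 < n" for n using pow_neq_one[OF q that] .
  have N: "(?N has_field_derivative - ?N 0 * ?a) (at 0)"
    by (rule prod_quad_deriv_0) (rule n1, simp)
  have E: "(?E has_field_derivative - ?E 0 * ?b) (at 0)"
    by (rule prod_quad_deriv_0) (rule n1, simp)
  have E0: "?E 0 \<noteq> 0" using n1 by (simp add: quad_def)
  have t: "cubic_term q u 1 k = c * (?N u / ?E u)" for u
    by (simp add: cubic_term_def cubic_weight_def c_def divide_inverse mult_ac)
  have "((\<lambda>u. c * (?N u / ?E u)) has_field_derivative
      c * ((- ?N 0 * ?a * ?E 0 - ?N 0 * (- ?E 0 * ?b)) / (?E 0 * ?E 0))) (at 0)"
    by (intro DERIV_cmult DERIV_divide N E E0)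
  moreover have "c * ((- ?N 0 * ?a * ?E 0 - ?N 0 * (- ?E 0 * ?b)) / (?E 0 * ?E 0)) = - (c * (?N 0 / ?E 0)) * (?a - ?b)"
    using E0 by (simp add: divide_simps) (simp add: algebra_simps)
  ultimately show ?thesis unfolding t sum_subtractf by simp
qed

text \<open>Termwise differentiation, justified by the majorant on an open disc around 0 whose
  radius is the bound on \<open>u\<close> in the earlier estimates.\<close>

lemma cubic_sum_deriv_0:
  assumes q: "0 < norm q" "norm q < 1"
  obtains T' where "((\<lambda>u. suminf (cubic_term q u 1)) has_field_derivative T') (at 0)"
    and "(\<lambda>k. - cubic_term q 0 1 k * (\<Sum>i<k. q ^ (2 * i + 1) / (1 - q ^ (2 * i + 1))\<^sup>2
        - q ^ (6 * i + 6) / (1 - q ^ (6 * i + 6))\<^sup>2)) sums T'"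
proof -
  define r where "r = (1 - norm q)\<^sup>2 / 2"
  have r: "0 < r" using q by (simp add: r_def)
  obtain g g' where g: "\<forall>u\<in>ball 0 r. (\<lambda>k. cubic_term q u 1 k) sums g u
      \<and> (\<lambda>k. deriv (\<lambda>u. cubic_term q u 1 k) u) sums g' u \<and> (g has_field_derivative g' u) (at u)"
  proof (rule series_and_derivative_comparison[of "ball 0 r" "\<lambda>k. 2 * majorant (norm q) k"
        "\<lambda>k u. cubic_term q u 1 k" "\<lambda>k. deriv (\<lambda>u. cubic_term q u 1 k)"])
    show "summable (\<lambda>k. 2 * majorant (norm q) k)"
      using q by (intro summable_mult summable_majorant) auto
    show "((\<lambda>u. cubic_term q u 1 k) has_field_derivative deriv (\<lambda>u. cubic_term q u 1 k) x) (at x)"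
      if "x \<in> ball 0 r" for k x
      using cubic_term_holomorphic[OF q] that unfolding r_def by (intro holomorphic_derivI) auto
    show "\<forall>\<^sub>F k in sequentially. \<forall>x\<in>ball 0 r. norm (cubic_term q x 1 k) \<le> 2 * majorant (norm q) k"
      using norm_cubic_term_le[OF q] by (intro always_eventually) (simp add: r_def)
  qed auto
  have "(g has_field_derivative g' 0) (at 0)" using g r by auto
  then have "((\<lambda>u. suminf (cubic_term q u 1)) has_field_derivative g' 0) (at 0)"
    by (rule has_field_derivative_transform_within_open[where S = "ball 0 r"])
      (use g r in \<open>auto simp: sums_iff\<close>)
  moreover have "(\<lambda>k. deriv (\<lambda>u. cubic_term q u 1 k) 0) sums g' 0" using g r by auto
  ultimately show ?thesis
    using that unfolding DERIV_imp_deriv[OF cubic_term_deriv_0[OF q(2)]] by blast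
qed

section \<open>Passage to \<open>q\<close>-integers and the final comparison\<close>

lemma qint_eq: "q \<noteq> 1 \<Longrightarrow> qint q n = (1 - q ^ n) / (1 - q)"
  by (simp add: qint_def sum_gp_strict)

lemma qint_quotient:
  assumes "q \<noteq> 1"
  shows "q ^ n / (qint q n)\<^sup>2 = (1 - q)\<^sup>2 * (q ^ n / (1 - q ^ n)\<^sup>2)"
  using assms by (simp add: qint_eq power_divide)

text \<open>Consecutive terms are paired: even \<open>m\<close> give the exponents
  \<open>6 * n + 3\<close> with sign plus, odd \<open>m\<close> the exponents
  \<open>6 * n + 6\<close> with sign minus.\<close>

lemma alternating_sum_eq:
  assumes q: "norm q < 1"
  shows "(\<Sum>m. (-1) ^ m * q ^ (3 * Suc m) / (qint q (3 * Suc m))\<^sup>2)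
    = (1 - q)\<^sup>2 * ((\<Sum>n. q ^ 3 * (q ^ 6) ^ n / (1 - q ^ 3 * (q ^ 6) ^ n)\<^sup>2)
        - (\<Sum>n. q ^ 6 * (q ^ 6) ^ n / (1 - q ^ 6 * (q ^ 6) ^ n)\<^sup>2))"
proof -
  define a :: "complex \<Rightarrow> complex" where "a y = y / (1 - y)\<^sup>2" for y
  have q1: "q \<noteq> 1" using q by auto
  have sa: "summable (\<lambda>n. a (x * p ^ n))" if "norm p < 1" for x p
    unfolding a_def by (rule summable_norm_cancel[OF summable_log_deriv[OF summable_geometric_terms[OF that]]])
  have q36: "norm (q ^ 3) < 1" "norm (q ^ 6) < 1" using pow_less_one[OF q] by auto
  define f where "f m = (-1) ^ m * a (q ^ (3 * Suc m))" for m
  have f_eq: "f (2 * n) + f (2 * n + 1) = a (q ^ 3 * (q ^ 6) ^ n) - a (q ^ 6 * (q ^ 6) ^ n)" for n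
    by (simp add: f_def power_mult[symmetric] power_add[symmetric])
  have "summable f"
  proof -
    have "summable (\<lambda>m. norm (a (q ^ 3 * (q ^ 3) ^ m)))"
      unfolding a_def by (rule summable_log_deriv[OF summable_geometric_terms[OF q36(1)]])
    then show ?thesis
      by (intro summable_norm_cancel[of f]) (simp add: f_def norm_mult norm_power power_add power_mult[symmetric])
  qed
  then have "(\<lambda>n. \<Sum>m\<in>{n * 2..<n * 2 + 2}. f m) sums suminf f"
    by (intro sums_group summable_sums) auto
  moreover have "(\<Sum>m\<in>{n * 2..<n * 2 + 2}. f m) = f (2 * n) + f (2 * n + 1)" for n
    by (simp add: mult.commute)
  moreover have "(\<lambda>n. a (q ^ 3 * (q ^ 6) ^ n) - a (q ^ 6 * (q ^ 6) ^ n)) sums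
     ((\<Sum>n. a (q ^ 3 * (q ^ 6) ^ n)) - (\<Sum>n. a (q ^ 6 * (q ^ 6) ^ n)))"
    by (intro sums_diff summable_sums sa q36)
  ultimately have "suminf f = (\<Sum>n. a (q ^ 3 * (q ^ 6) ^ n)) - (\<Sum>n. a (q ^ 6 * (q ^ 6) ^ n))"
    using sums_unique2 by (simp only: f_eq) blast
  moreover have "(-1) ^ m * q ^ (3 * Suc m) / (qint q (3 * Suc m))\<^sup>2 = (1 - q)\<^sup>2 * f m" for m
    using qint_quotient[OF q1, of "3 * Suc m"] unfolding f_def a_def
    by (metis (no_types, lifting) mult.left_commute times_divide_eq_right)
  ultimately show ?thesis
    using \<open>summable f\<close> by (simp only: suminf_mult a_def)
qed

theorem theorem1p5:
  fixes q :: complex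
  assumes "0 < norm q" and "norm q < 1"
  shows "(\<lambda>m. let k = Suc m in
            q ^ (2 * k\<^sup>2) * qint q (8 * k + 1)
            * (qpoch q (q\<^sup>2) k ^ 2 * qpoch q (q\<^sup>2) (2 * k))
              / (qpoch (q\<^sup>2) (q\<^sup>2) (2 * k) * qpoch (q ^ 6) (q ^ 6) k ^ 2)
            * (\<Sum>i=1..k. q ^ (2 * i - 1) / (qint q (2 * i - 1))\<^sup>2
                          - q ^ (6 * i) / (qint q (6 * i))\<^sup>2))
         sums
         ((qpoch_inf (q ^ 3) (q\<^sup>2) * qpoch_inf (q ^ 3) (q ^ 6))
            / (qpoch_inf (q\<^sup>2) (q\<^sup>2) * qpoch_inf (q ^ 6) (q ^ 6))
          * (\<Sum>m. let j = Suc m in (-1) ^ (j - 1) * q ^ (3 * j) / (qint q (3 * j))\<^sup>2))"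
proof -
  note q = assms
  define r where "r = (1 - norm q)\<^sup>2 / 2"
  define T where "T u = suminf (cubic_term q u 1)" for u
  define R where "R c u = (\<Prod>n. quad u (q ^ c * (q ^ 6) ^ n))" for c u
  define \<sigma> where "\<sigma> c = (\<Sum>n. q ^ c * (q ^ 6) ^ n / (1 - q ^ c * (q ^ 6) ^ n)\<^sup>2)" for c
  define A where "A = qpoch_inf (q\<^sup>2) (q ^ 6) * qpoch_inf (q ^ 4) (q ^ 6)"
  define B where "B = qpoch_inf q (q ^ 6) * qpoch_inf (q ^ 5) (q ^ 6)"
  define G where "G k = (\<Sum>i<k. q ^ (2 * i + 1) / (1 - q ^ (2 * i + 1))\<^sup>2
        - q ^ (6 * i + 6) / (1 - q ^ (6 * i + 6))\<^sup>2)" for k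
  define C where "C = (qpoch_inf (q ^ 3) (q\<^sup>2) * qpoch_inf (q ^ 3) (q ^ 6))
            / (qpoch_inf (q\<^sup>2) (q\<^sup>2) * qpoch_inf (q ^ 6) (q ^ 6))"
  have r: "0 < r" using q by (simp add: r_def)
  have q1: "q \<noteq> 1" using q by auto
  have pl: "norm (q ^ n) < 1" if "0 < n" for n using pow_less_one[OF q(2) that] .
  have R': "(R c has_field_derivative - R c 0 * \<sigma> c) (at 0)" if "0 < c" for c
    unfolding R_def \<sigma>_def using that
    by (intro prodinf_quad_deriv_0 summable_geometric_terms norm_geometric_term_less pl) auto
  have R0: "R c 0 = (qpoch_inf (q ^ c) (q ^ 6))\<^sup>2" if "0 < c" for c
    unfolding R_def using that by (intro prodinf_quad_0 pl) auto
  have A0: "A \<noteq> 0" unfolding A_def using pl by (auto simp: qpoch_inf_nonzero)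
  have q66: "qpoch_inf (q ^ 6) (q ^ 6) \<noteq> 0" using pl by (simp add: qpoch_inf_nonzero)
  obtain T' where T': "(T has_field_derivative T') (at 0)"
      "(\<lambda>k. - cubic_term q 0 1 k * G k) sums T'"
    using cubic_sum_deriv_0[OF q] unfolding T_def G_def by blast
  have id: "A * (R 6 u * T u) = B * R 3 u" if "u \<in> ball 0 r" for u
    using cubic_summation[OF q, of u] that unfolding A_def B_def R_def T_def r_def
    by (simp add: mult_ac)
  \<comment> \<open>Both sides of \<open>id\<close> are differentiated at 0. Using \<open>id\<close>
    at 0 once more then exposes the common factor \<open>A * R 6 0\<close>, which is nonzero and
    cancels.\<close>
  have "((\<lambda>u. A * (R 6 u * T u)) has_field_derivative A * (- R 6 0 * \<sigma> 6 * T 0 + T' * R 6 0)) (at 0)"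
    by (intro DERIV_cmult DERIV_mult R' T') auto
  moreover have "((\<lambda>u. A * (R 6 u * T u)) has_field_derivative B * (- R 3 0 * \<sigma> 3)) (at 0)"
    by (rule has_field_derivative_transform_within_open[where S = "ball 0 r", OF DERIV_cmult[OF R']])
      (use r id in auto)
  ultimately have "A * (- R 6 0 * \<sigma> 6 * T 0 + T' * R 6 0) = B * (- R 3 0 * \<sigma> 3)"
    by (rule DERIV_unique)
  also have "\<dots> = - (A * (R 6 0 * T 0)) * \<sigma> 3" using id[of 0] r by simp
  finally have "A * R 6 0 * (T' - T 0 * (\<sigma> 6 - \<sigma> 3)) = 0" by (simp add: algebra_simps)
  then have T'_eq: "T' = T 0 * (\<sigma> 6 - \<sigma> 3)" using A0 q66 by (simp add: R0)
  \<comment> \<open>The summation itself at \<open>u = 0\<close>, with its base \<open>q ^ 6\<close>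
    products regrouped into base \<open>q\<^sup>2\<close> by trisection.\<close>
  have T0: "T 0 = (1 - q) * C"
  proof -
    have q2: "norm (q\<^sup>2) < 1" using pl by simp
    have e: "(q\<^sup>2) ^ 3 = q ^ 6" "q * q\<^sup>2 = q ^ 3" "q * (q\<^sup>2)\<^sup>2 = q ^ 5" "q\<^sup>2 * q\<^sup>2 = q ^ 4" "q\<^sup>2 * (q\<^sup>2)\<^sup>2 = q ^ 6"
      by (simp_all add: eval_nat_numeral mult_ac)
    have "(1 - q) * qpoch_inf (q ^ 3) (q\<^sup>2) = B * qpoch_inf (q ^ 3) (q ^ 6)"
      using qpoch_inf_head[OF q2, of q] qpoch_inf_trisect[OF q2, of q] unfolding e B_def by (simp add: mult_ac)
    moreover have "qpoch_inf (q\<^sup>2) (q\<^sup>2) = A * qpoch_inf (q ^ 6) (q ^ 6)"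
      using qpoch_inf_trisect[OF q2, of "q\<^sup>2"] unfolding e A_def by (simp add: mult_ac)
    ultimately have "(1 - q) * C = B * R 3 0 / (A * R 6 0)"
      unfolding C_def by (simp add: R0 power2_eq_square mult_ac)
    also have "\<dots> = A * (R 6 0 * T 0) / (A * R 6 0)" using id[of 0] r by simp
    also have "\<dots> = T 0" using A0 q66 by (simp add: R0)
    finally show ?thesis by simp
  qed
  \<comment> \<open>The factor \<open>qint q (8 * k + 1)\<close> contributes
    \<open>1 / (1 - q)\<close> and the inner sum \<open>(1 - q)\<^sup>2\<close>, leaving
    \<open>1 - q\<close>. The double sign keeps the form of the series for
    \<open>T'\<close>.\<close>
  have term_eq: "q ^ (2 * k\<^sup>2) * qint q (8 * k + 1)
            * (qpoch q (q\<^sup>2) k ^ 2 * qpoch q (q\<^sup>2) (2 * k))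
              / (qpoch (q\<^sup>2) (q\<^sup>2) (2 * k) * qpoch (q ^ 6) (q ^ 6) k ^ 2)
            * (\<Sum>i=1..k. q ^ (2 * i - 1) / (qint q (2 * i - 1))\<^sup>2 - q ^ (6 * i) / (qint q (6 * i))\<^sup>2)
      = - (1 - q) * (- cubic_term q 0 1 k * G k)" for k
  proof -
    have N: "(\<Prod>i<k. quad 0 (q ^ (2 * i + 1))) = (qpoch q (q\<^sup>2) k)\<^sup>2"
      "(\<Prod>i<k. quad 0 (1 * q ^ (6 * i + 6))) = (qpoch (q ^ 6) (q ^ 6) k)\<^sup>2"
      by (simp_all add: quad_def qpoch_def prod_power_distrib power_add power_mult[symmetric] mult.commute)
    have "(\<Sum>i=1..k. q ^ (2 * i - 1) / (qint q (2 * i - 1))\<^sup>2 - q ^ (6 * i) / (qint q (6 * i))\<^sup>2)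
       = (\<Sum>i<k. q ^ (2 * i + 1) / (qint q (2 * i + 1))\<^sup>2 - q ^ (6 * i + 6) / (qint q (6 * i + 6))\<^sup>2)"
      by (simp add: sum.atLeast1_atMost_eq add.commute)
    also have "\<dots> = (1 - q)\<^sup>2 * G k"
      unfolding qint_quotient[OF q1] G_def by (simp add: sum_distrib_left right_diff_distrib)
    finally have S: "(\<Sum>i=1..k. q ^ (2 * i - 1) / (qint q (2 * i - 1))\<^sup>2 - q ^ (6 * i) / (qint q (6 * i))\<^sup>2)
       = (1 - q)\<^sup>2 * G k" .
    have cancel: "a * (b / (1 - q)) * c / e * ((1 - q)\<^sup>2 * g) = (1 - q) * (b * (a * c / e) * g)"
      for a b c e g :: complex
      using q1 by (simp add: power2_eq_square mult_ac)
    show ?thesis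
      unfolding S unfolding qint_eq[OF q1] cancel unfolding cubic_term_def cubic_weight_def N
      by (simp only: mult_minus_left mult_minus_right minus_minus mult_1 mult_ac)
  qed
  have "(\<lambda>k. - (1 - q) * (- cubic_term q 0 1 k * G k)) sums (- (1 - q) * T')"
    by (intro sums_mult T')
  \<comment> \<open>The inner sum is empty at \<open>k = 0\<close>, so dropping this term to start
    at \<open>k = 1\<close> leaves the value unchanged.\<close>
  moreover have "G 0 = 0" by (simp add: G_def)
  ultimately have "(\<lambda>m. - (1 - q) * (- cubic_term q 0 1 (Suc m) * G (Suc m))) sums (- (1 - q) * T')"
    by (subst sums_Suc_iff) simp
  moreover have "- (1 - q) * T' = C * ((1 - q)\<^sup>2 * (\<sigma> 3 - \<sigma> 6))"
    unfolding T'_eq T0 by (simp add: power2_eq_square algebra_simps)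
  ultimately show ?thesis
    unfolding Let_def diff_Suc_1 alternating_sum_eq[OF q(2)] term_eq C_def \<sigma>_def by simp
qed

end
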